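(* Let $m,n\in\mathbb{N}$ and let $f\in C^\infty(\mathbb{T}^m\times\mathbb{R}^n)\cap L^1(\mathbb{T}^m\times\mathbb{R}^n)$. Then $f\in\mathcal{S}(\mathbb{T}^m\times\mathbb{R}^n)$ if and only if for every $\beta\in\mathbb{N}_0^n$ and every $N>0$ there exists $C_{N,\beta}>0$ such that $$|\partial_x^\beta\widehat{f}(k,x)|\leq C_{N,\beta}(1+|k|^2)^{-N/2}(1+|x|^2)^{-N/2}$$ for every $k\in\mathbb{Z}^m$ and $x\in\mathbb{R}^n$.
   Context: $\mathbb{T}^m=(\mathbb{R}/2\pi\mathbb{Z})^m$; functions on $\mathbb{T}^m\times\mathbb{R}^n$ (variables $(t,x)$) are identified with functions on $\mathbb{R}^{m+n}$ that are $2\pi$-periodic in each of the first $m$ variables. $\mathbb{N}_0$ denotes the nonnegative integers. $\mathcal{S}(\mathbb{T}^m\times\mathbb{R}^n)$ is the set of all $f\in C^\infty(\mathbb{T}^m\times\mathbb{R}^n)$ (complex valued) such that $\|f\|_{\alpha,\beta,\gamma}:=\sup_{(t,x)\in\mathbb{T}^m\times\mathbb{R}^n}|x^\gamma\partial_t^\alpha\partial_x^\beta f(t,x)|<+\infty$ for all $\alpha\in\mathbb{N}_0^m$, $\beta,\gamma\in\mathbb{N}_0^n$. The partial Fourier coefficients on the torus are $\widehat{f}(k,x)=\mathcal{F}_{\mathbb{T}^m}(f)(k,x):=\frac{1}{(2\pi)^m}\int_{[0,2\pi]^m}f(t,x)e^{-ik\cdot t}\,dt$ for $k\in\mathbb{Z}^m$,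 $x\in\mathbb{R}^n$. *)

theory Defs
  imports "HOL-Analysis.Analysis"
begin

text \<open>
  Functions on \<open>T^m \<times> R^n\<close> are functions on \<^typ>\<open>(real^'m) \<times> (real^'n)\<close> that are
  \<open>2 * pi\<close>-periodic in each of the first \<open>m = CARD('m)\<close> coordinates.
\<close>

definition torus_periodic :: "((real^'m) \<times> 'a \<Rightarrow> 'b) \<Rightarrow> bool" where
  "torus_periodic f \<longleftrightarrow> (\<forall>t x i. f (t + axis i (2 * pi), x) = f (t, x))"

definition torus_cell :: "(real^'m) set" where
  "torus_cell = cbox 0 (\<chi> i. 2 * pi)"


definition partial_deriv ::
    "'a::real_normed_vector \<Rightarrow> ('a \<Rightarrow> 'b::real_normed_vector) \<Rightarrow> 'a \<Rightarrow> 'b" where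
  "partial_deriv v f z = vector_derivative (\<lambda>s. f (z + s *\<^sub>R v)) (at 0)"

definition C_infinity :: "('a::euclidean_space \<Rightarrow> 'b::real_normed_vector) \<Rightarrow> bool" where
  "C_infinity f \<longleftrightarrow>
     (\<forall>vs. set vs \<subseteq> Basis \<longrightarrow>
        continuous_on UNIV (foldr partial_deriv vs f) \<and>
        (\<forall>v\<in>Basis. \<forall>z. (\<lambda>s. foldr partial_deriv vs f (z + s *\<^sub>R v)) differentiable (at 0)))"

text \<open>
  A finite index type carries no canonical order, so the partial derivatives in a multi-index
  derivative are taken in the order of an arbitrary fixed enumeration of the index type; for smooth
  functions the order is irrelevant.
\<close>

definition index_enum :: "'i::finite list" where
  "index_enum = (SOME is. distinct is \<and> set is = UNIV)"

lemma index_enum: "distinct (index_enum :: 'i::finite list)" "set (index_enum :: 'i list) = UNIV"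
proof -
  have "\<exists>is :: 'i list. distinct is \<and> set is = UNIV"
    using finite_distinct_list[of "UNIV :: 'i set"] by auto
  then have "distinct (index_enum :: 'i list) \<and> set (index_enum :: 'i list) = UNIV"
    unfolding index_enum_def by (rule someI_ex)
  then show "distinct (index_enum :: 'i list)" "set (index_enum :: 'i list) = UNIV"
    by auto
qed

text \<open>The derivative of multi-order \<open>\<alpha>\<close>, with \<open>\<alpha> $ i\<close> derivatives in the direction \<open>e i\<close>.\<close>

definition multi_deriv ::
    "('i::finite \<Rightarrow> 'a::real_normed_vector) \<Rightarrow> nat^'i \<Rightarrow>
     ('a \<Rightarrow> 'b::real_normed_vector) \<Rightarrow> 'a \<Rightarrow> 'b" where
  "multi_deriv e \<alpha> f = foldr (\<lambda>i. partial_deriv (e i) ^^ (\<alpha> $ i)) index_enum f"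

abbreviation deriv_t ::
    "nat^'m \<Rightarrow> ((real^'m) \<times> (real^'n) \<Rightarrow> complex) \<Rightarrow> (real^'m) \<times> (real^'n) \<Rightarrow> complex" where
  "deriv_t \<equiv> multi_deriv (\<lambda>i. (axis i 1, 0))"

abbreviation deriv_x ::
    "nat^'n \<Rightarrow> ((real^'m) \<times> (real^'n) \<Rightarrow> complex) \<Rightarrow> (real^'m) \<times> (real^'n) \<Rightarrow> complex" where
  "deriv_x \<equiv> multi_deriv (\<lambda>j. (0, axis j 1))"

abbreviation deriv_vec :: "nat^'n \<Rightarrow> (real^'n \<Rightarrow> complex) \<Rightarrow> real^'n \<Rightarrow> complex" where
  "deriv_vec \<equiv> multi_deriv (\<lambda>j. axis j 1)"

definition monomial :: "nat^'n \<Rightarrow> real^'n \<Rightarrow> real" where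
  "monomial \<gamma> x = (\<Prod>j\<in>UNIV. (x $ j) ^ (\<gamma> $ j))"


definition smooth_torus :: "((real^'m) \<times> (real^'n) \<Rightarrow> complex) set" where
  "smooth_torus = {f. torus_periodic f \<and> C_infinity f}"

definition L1_torus :: "((real^'m) \<times> (real^'n) \<Rightarrow> complex) set" where
  "L1_torus = {f. torus_periodic f \<and> set_integrable lborel (torus_cell \<times> UNIV) f}"

text \<open>The seminorm is extended-real valued, so that its finiteness is a genuine condition.\<close>

definition schwartz_seminorm ::
    "nat^'m \<Rightarrow> nat^'n \<Rightarrow> nat^'n \<Rightarrow> ((real^'m) \<times> (real^'n) \<Rightarrow> complex) \<Rightarrow> ereal" where
  "schwartz_seminorm \<alpha> \<beta> \<gamma> f =
     (SUP (t, x)\<in>UNIV. ereal (cmod (of_real (monomial \<gamma> x) * deriv_t \<alpha> (deriv_x \<beta> f) (t, x))))"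

definition schwartz_torus :: "((real^'m) \<times> (real^'n) \<Rightarrow> complex) set" where
  "schwartz_torus = {f \<in> smooth_torus. \<forall>\<alpha> \<beta> \<gamma>. schwartz_seminorm \<alpha> \<beta> \<gamma> f < \<infinity>}"

definition real_vec :: "int^'m \<Rightarrow> real^'m" where
  "real_vec k = (\<chi> i. real_of_int (k $ i))"

definition torus_fourier ::
    "((real^'m) \<times> (real^'n) \<Rightarrow> complex) \<Rightarrow> int^'m \<Rightarrow> real^'n \<Rightarrow> complex" where
  "torus_fourier f k x =
     1 / (2 * of_real pi) ^ CARD('m) *
     (LINT t:torus_cell|lborel. f (t, x) * exp (- \<i> * of_real (real_vec k \<bullet> t)))"

end

theory Submission
  imports Defs
begin

text \<open>
  The partial Fourier transform commutes with derivatives in \<open>x\<close> (\<open>deriv_vec_torus_fourier\<close>) and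
  turns \<open>\<partial>\<^sub>t^\<alpha>\<close> into multiplication by \<open>(i k)^\<alpha>\<close> (\<open>torus_fourier_deriv_t\<close>). So with
  \<open>g = \<partial>\<^sub>x^\<beta> f\<close> the quantity \<open>\<bar>k^\<alpha>\<bar> \<bar>x^\<gamma>\<bar> \<bar>\<partial>\<^sub>x^\<beta> F(k, x)\<bar>\<close>, where \<open>F\<close> is the transform of \<open>f\<close>,
  is the absolute value of a Fourier coefficient of \<open>t \<mapsto> x^\<gamma> \<partial>\<^sub>t^\<alpha> g (t, x)\<close>.

  If \<open>f\<close> is a Schwartz function, this coefficient is at most the supremum of that function,
  which is a seminorm of \<open>f\<close>. The weights \<open>(1 + \<bar>k\<bar>\<^sup>2)^M\<close> and \<open>(1 + \<bar>x\<bar>\<^sup>2)^M\<close> are bounded by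
  finite sums of absolute values of monomials, which gives the decay
  (\<open>fourier_decay_of_seminorms\<close>).

  For the converse one has to return from coefficients to functions. Instead of inverting the
  Fourier series it suffices to know that a continuous periodic function is bounded by the sum
  of the absolute values of its coefficients (\<open>norm_le_sum_fourier_coeffs\<close>). To see this, the
  function is tested against the powers of the nonnegative trigonometric polynomial
  \<open>\<Prod>\<^sub>i (1 - cos t\<^sub>i) / 2\<close>: on the one hand they concentrate at one point; on the other hand none
  of the Fourier coefficients of such a power exceeds its mean, so that the mean of the function
  against it is at most the sum of the coefficients of the function times the mean of the power.
  The assumed decay, with exponent large enough to absorb \<open>k^\<alpha>\<close>, \<open>x^\<gamma>\<close> and a summable weight on
  the lattice, then bounds the seminorms (\<open>seminorm_bound_of_fourier_decay\<close>).

  All functions that are integrated are continuous on a compact cell, so the gauge integral over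
  the cell is used throughout. Its translation invariance on periodic functions
  (\<open>torus_mean_shift\<close>) is the common source of the orthogonality of the characters, of the rule
  for torus derivatives, and of the freedom to place the peak of the kernel.
\<close>

section \<open>The normalised mean of a periodic function\<close>

definition torus_mean :: "(real^'m \<Rightarrow> 'b::euclidean_space) \<Rightarrow> 'b" where
  "torus_mean h = integral torus_cell h /\<^sub>R (2 * pi) ^ CARD('m)"

definition periodic :: "(real^'m \<Rightarrow> 'b) \<Rightarrow> bool" where
  "periodic h \<longleftrightarrow> (\<forall>t i. h (t + axis i (2 * pi)) = h t)"

definition torus_char :: "int^'m \<Rightarrow> real^'m \<Rightarrow> complex" where
  "torus_char k t = cis (real_vec k \<bullet> t)"

lemma integrable_torus_cell:
  fixes h :: "real^'m \<Rightarrow> 'b::euclidean_space"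
  assumes "continuous_on UNIV h"
  shows "h integrable_on torus_cell"
  unfolding torus_cell_def
  by (rule integrable_continuous) (rule continuous_on_subset[OF assms], simp)

lemma content_torus_cell: "measure lborel (torus_cell :: (real^'m) set) = (2 * pi) ^ CARD('m)"
proof -
  have "cbox (0::real^'m) (\<chi> i. 2 * pi) \<noteq> {}"
    by (auto simp: interval_ne_empty_cart)
  then show ?thesis
    unfolding torus_cell_def by (simp add: content_cbox_cart)
qed

lemma torus_mean_add:
  assumes "continuous_on UNIV g" "continuous_on UNIV h"
  shows "torus_mean (\<lambda>t. g t + h t) = torus_mean g + torus_mean h"
  using assms
  by (simp add: torus_mean_def integral_add integrable_torus_cell scaleR_right_distrib)

lemma torus_mean_mult_left:
  fixes h :: "real^'m \<Rightarrow> complex"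
  shows "torus_mean (\<lambda>t. c * h t) = c * torus_mean h"
  by (simp add: torus_mean_def)

lemma torus_mean_sum:
  assumes "finite F" "\<And>k. k \<in> F \<Longrightarrow> continuous_on UNIV (g k)"
  shows "torus_mean (\<lambda>t. \<Sum>k\<in>F. g k t) = (\<Sum>k\<in>F. torus_mean (g k))"
  using assms by (simp add: torus_mean_def integral_sum integrable_torus_cell scaleR_sum_right)

lemma torus_mean_const: "torus_mean (\<lambda>t::real^'m. c) = c"
proof -
  have "integral (torus_cell :: (real^'m) set) (\<lambda>t. c) = (2 * pi) ^ CARD('m) *\<^sub>R c"
    using content_torus_cell[where 'm='m] unfolding torus_cell_def by simp
  moreover have "(2 * pi) ^ CARD('m) \<noteq> 0" by simp
  ultimately show ?thesis
    by (simp only: torus_mean_def scaleR_scaleR left_inverse scaleR_one not_False_eq_True)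
qed

lemma norm_torus_mean_le:
  assumes "continuous_on UNIV h" "continuous_on UNIV r" "\<And>t. norm (h t) \<le> r t"
  shows "norm (torus_mean h) \<le> torus_mean r"
proof -
  have "norm (integral torus_cell h) \<le> integral torus_cell r"
    using assms by (intro integral_norm_bound_integral integrable_torus_cell)
  then show ?thesis by (simp add: torus_mean_def divide_right_mono mult_left_mono)
qed

definition slab :: "'m \<Rightarrow> real \<Rightarrow> real \<Rightarrow> (real^'m) set" where
  "slab i a b = cbox (\<chi> j. if j = i then a else 0) (\<chi> j. if j = i then b else 2 * pi)"

lemma mem_slab: "t \<in> slab i a b \<longleftrightarrow> a \<le> t $ i \<and> t $ i \<le> b \<and> (\<forall>j. j \<noteq> i \<longrightarrow> 0 \<le> t $ j \<and> t $ j \<le> 2 * pi)"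
  unfolding slab_def mem_box_cart by auto

lemma integral_slab_combine:
  fixes h :: "real^'m \<Rightarrow> 'b::euclidean_space"
  assumes "continuous_on UNIV h" "a \<le> b" "b \<le> c"
  shows "integral (slab i a b) h + integral (slab i b c) h = integral (slab i a c) h"
proof -
  have int: "h integrable_on slab i a c"
    unfolding slab_def by (rule integrable_continuous) (rule continuous_on_subset[OF assms(1)], simp)
  have "integral (slab i a c) h =
      integral (slab i a c \<inter> {x. x \<bullet> axis i 1 \<le> b}) h + integral (slab i a c \<inter> {x. x \<bullet> axis i 1 \<ge> b}) h"
    using int unfolding slab_def by (rule integral_split) simp
  moreover have "slab i a c \<inter> {x. x \<bullet> axis i 1 \<le> b} = slab i a b"
    "slab i a c \<inter> {x. x \<bullet> axis i 1 \<ge> b} = slab i b c"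
    using assms by (auto simp: mem_slab inner_axis)
  ultimately show ?thesis by simp
qed

lemma integral_slab_shift:
  fixes h :: "real^'m \<Rightarrow> 'b::euclidean_space"
  shows "integral (slab i a b) (\<lambda>t. h (t + axis i s)) = integral (slab i (a + s) (b + s)) h"
proof -
  have "(\<chi> j. if j = i then a + s else 0) - axis i s = (\<chi> j. if j = i then a else 0)"
    "(\<chi> j. if j = i then b + s else 2 * pi) - axis i s = (\<chi> j. if j = i then b else 2 * pi)"
    by (auto simp: vec_eq_iff axis_def)
  then show ?thesis
    using integral_shift_cbox[of "\<chi> j. if j = i then a + s else 0" "axis i s" "\<chi> j. if j = i then b + s else 2 * pi" h]
    unfolding slab_def by simp
qed

lemma continuous_on_shift:
  fixes h :: "'a::real_normed_vector \<Rightarrow> 'b::topological_space"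
  assumes "continuous_on UNIV h"
  shows "continuous_on UNIV (\<lambda>t. h (t + a))"
  by (rule continuous_on_compose2[OF assms]) (auto intro!: continuous_intros)

lemma periodic_shift: "periodic h \<Longrightarrow> periodic (\<lambda>t. h (t + a))"
  unfolding periodic_def by (metis add.commute add.left_commute)

text \<open>
  Haar invariance, one coordinate at a time: after the shift the cell becomes a slab that is cut
  at two places, and the piece that sticks out is by periodicity a copy of the piece that is
  missing.
\<close>

lemma torus_mean_shift_axis:
  fixes h :: "real^'m \<Rightarrow> 'b::euclidean_space"
  assumes "continuous_on UNIV h" "periodic h"
  shows "torus_mean (\<lambda>t. h (t + axis i s)) = torus_mean h"
proof -
  have cell: "torus_cell = slab i 0 (2 * pi)"
    by (auto simp: torus_cell_def mem_slab mem_box_cart)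
  have pos: "integral torus_cell (\<lambda>t. h (t + axis i s)) = integral torus_cell h"
    if "s \<ge> 0" "continuous_on UNIV h" "periodic h" for s and h :: "real^'m \<Rightarrow> 'b"
  proof -
    have "integral (slab i (0 + 2 * pi) (s + 2 * pi)) h = integral (slab i 0 s) h"
      using that(3) by (subst integral_slab_shift[symmetric]) (simp add: periodic_def)
    \<comment> \<open>Both sides are the integral over the slab from \<open>0\<close> to \<open>s + 2 * pi\<close>.\<close>
    moreover have "integral (slab i 0 s) h + integral (slab i s (s + 2 * pi)) h =
        integral (slab i 0 (2 * pi)) h + integral (slab i (2 * pi) (s + 2 * pi)) h"
      using that by (simp add: integral_slab_combine)
    ultimately show ?thesis
      unfolding cell integral_slab_shift by (simp add: add.commute)
  qed
  show ?thesis
  proof (cases "s \<ge> 0")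
    case True
    then show ?thesis using pos assms by (simp add: torus_mean_def)
  next
    case False
    have "axis i s + axis i (- s) = (0::real^'m)"
      by (simp add: vec_eq_iff axis_def)
    then have "h (t + axis i (- s) + axis i s) = h t" for t
      by (metis add.assoc add.commute add.right_neutral)
    then show ?thesis
      using pos[of "- s" "\<lambda>t. h (t + axis i s)"] False assms
      by (simp add: torus_mean_def periodic_shift continuous_on_shift)
  qed
qed

lemma torus_mean_shift:
  fixes h :: "real^'m \<Rightarrow> 'b::euclidean_space"
  assumes "continuous_on UNIV h" "periodic h"
  shows "torus_mean (\<lambda>t. h (t + a)) = torus_mean h"
proof -
  have "torus_mean (\<lambda>t. h (t + (\<Sum>i\<in>I. axis i (a $ i)))) = torus_mean h" if "finite I" for I
    using that
  proof (induction I)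
    case (insert i I)
    have "torus_mean (\<lambda>t. h (t + axis i (a $ i) + (\<Sum>i\<in>I. axis i (a $ i)))) =
        torus_mean (\<lambda>t. h (t + (\<Sum>i\<in>I. axis i (a $ i))))"
      by (rule torus_mean_shift_axis[of "\<lambda>t. h (t + (\<Sum>i\<in>I. axis i (a $ i)))"])
        (use assms in \<open>auto intro: continuous_on_shift periodic_shift\<close>)
    then show ?case using insert by (simp add: add.assoc)
  qed simp
  moreover have "(\<Sum>i\<in>UNIV. axis i (a $ i)) = a"
    by (simp add: vec_eq_iff axis_def)
  ultimately show ?thesis by (metis finite)
qed

section \<open>Characters and Fourier coefficients\<close>

lemma real_vec_simps [simp]:
  "real_vec 0 = 0" "real_vec (- k) = - real_vec k" "real_vec (k + l) = real_vec k + real_vec l"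
  "real_vec k $ i = real_of_int (k $ i)" "real_vec (axis i 1) = axis i 1"
  by (auto simp: real_vec_def vec_eq_iff axis_def)

lemma continuous_torus_char: "continuous_on A (torus_char k)"
  unfolding torus_char_def by (intro continuous_intros)

lemma torus_char_add: "torus_char (k + l) t = torus_char k t * torus_char l t"
  by (simp add: torus_char_def cis_mult inner_add_left)

lemma torus_char_plus: "torus_char k (t + a) = torus_char k t * torus_char k a"
  by (simp add: torus_char_def cis_mult inner_add_right)

lemma torus_char_0 [simp]: "torus_char 0 t = 1"
  by (simp add: torus_char_def)

lemma norm_torus_char [simp]: "cmod (torus_char k t) = 1"
  by (simp add: torus_char_def)

lemma torus_char_inverse [simp]: "torus_char k t * torus_char (- k) t = 1"
  by (simp add: torus_char_def cis_mult)

lemma periodic_torus_char: "periodic (torus_char k)"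
proof -
  have "torus_char k (axis i (2 * pi)) = 1" for i
    using cis_multiple_2pi[of "real_of_int (k $ i)"]
    by (simp add: torus_char_def inner_axis ac_simps)
  then show ?thesis by (simp add: periodic_def torus_char_plus)
qed

lemma periodic_mult_torus_char: "periodic h \<Longrightarrow> periodic (\<lambda>t. h t * torus_char k t)"
  using periodic_torus_char[of k] by (simp add: periodic_def)

text \<open>
  A translation of the function multiplies its Fourier coefficients by a phase. This identity is
  used twice: the phase has modulus one, so the peak of a kernel may be moved to any point; and
  differentiating it in \<open>a\<close> yields the effect of a derivative on the coefficients.
\<close>

lemma torus_coeff_shift:
  assumes "continuous_on UNIV h" "periodic h"
  shows "torus_mean (\<lambda>t. h (t + a) * torus_char (- k) t) =
    torus_char k a * torus_mean (\<lambda>t. h t * torus_char (- k) t)"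
proof -
  have "torus_mean (\<lambda>t. h (t + a) * torus_char (- k) (t + a)) = torus_mean (\<lambda>t. h t * torus_char (- k) t)"
    by (rule torus_mean_shift[of "\<lambda>t. h t * torus_char (- k) t"])
      (use assms in \<open>auto intro!: continuous_intros continuous_torus_char periodic_mult_torus_char\<close>)
  moreover have "h (t + a) * torus_char (- k) t = torus_char k a * (h (t + a) * torus_char (- k) (t + a))" for t
    by (simp add: torus_char_plus algebra_simps)
  ultimately show ?thesis
    by (simp only: torus_mean_mult_left)
qed

text \<open>
  The mean of a nontrivial character is unchanged when it is multiplied by a value of that
  character, in particular by the value \<open>-1\<close>, so it vanishes.
\<close>

lemma torus_mean_char: "torus_mean (torus_char k) = (if k = 0 then 1 else 0)"
proof (cases "k = 0")
  case True
  then show ?thesis by (simp add: torus_mean_const torus_char_def[abs_def])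
next
  case False
  then obtain i where i: "k $ i \<noteq> 0" by (auto simp: vec_eq_iff)
  define a :: "real^'a" where "a = axis i (pi / k $ i)"
  have "torus_char k a = -1"
    using i by (simp add: torus_char_def a_def inner_axis)
  moreover have "torus_mean (torus_char k) = torus_char k a * torus_mean (torus_char k)"
    using torus_mean_shift[OF continuous_torus_char periodic_torus_char, of k a]
    by (simp add: torus_char_plus mult.commute[of _ "torus_char k a"] torus_mean_mult_left)
  ultimately show ?thesis using False by simp
qed

section \<open>Recovering the supremum norm from the Fourier coefficients\<close>

definition trig_poly :: "(real^'m \<Rightarrow> complex) \<Rightarrow> bool" where
  "trig_poly p \<longleftrightarrow> (\<exists>F a. finite F \<and> p = (\<lambda>t. \<Sum>k\<in>F. a k * torus_char k t))"

text \<open>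
  Multiplication by a character translates the frequencies. Together with closure under addition
  this gives closure under products, so that powers of the kernel below never have to be
  expanded.
\<close>

lemma trig_poly_cmult_char:
  assumes "trig_poly p"
  shows "trig_poly (\<lambda>t. c * torus_char l t * p t)"
proof -
  obtain F a where F: "finite F" "p = (\<lambda>t. \<Sum>k\<in>F. a k * torus_char k t)"
    using assms by (auto simp: trig_poly_def)
  have "(\<Sum>k\<in>(\<lambda>k. l + k) ` F. (c * a (k - l)) * torus_char k t) = c * torus_char l t * p t" for t
    by (subst sum.reindex) (auto simp: F torus_char_add sum_distrib_left mult_ac)
  then show ?thesis
    unfolding trig_poly_def using F(1)
    by (intro exI[of _ "(\<lambda>k. l + k) ` F"] exI[of _ "\<lambda>k. c * a (k - l)"]) auto
qed

lemma trig_poly_const: "trig_poly (\<lambda>t. c)"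
  unfolding trig_poly_def by (intro exI[of _ "{0}"] exI[of _ "\<lambda>_. c"]) auto

lemma trig_poly_add:
  assumes "trig_poly p" "trig_poly r"
  shows "trig_poly (\<lambda>t. p t + r t)"
proof -
  obtain F a where F: "finite F" "p = (\<lambda>t. \<Sum>k\<in>F. a k * torus_char k t)"
    using assms by (auto simp: trig_poly_def)
  obtain G b where G: "finite G" "r = (\<lambda>t. \<Sum>k\<in>G. b k * torus_char k t)"
    using assms by (auto simp: trig_poly_def)
  define d where "d k = (if k \<in> F then a k else 0) + (if k \<in> G then b k else 0)" for k
  have "(\<Sum>k\<in>F \<union> G. d k * torus_char k t) = p t + r t" for t
  proof -
    have "(\<Sum>k\<in>F \<union> G. d k * torus_char k t) =
        (\<Sum>k\<in>F \<union> G. if k \<in> F then a k * torus_char k t else 0) +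
        (\<Sum>k\<in>F \<union> G. if k \<in> G then b k * torus_char k t else 0)"
      unfolding sum.distrib[symmetric] by (intro sum.cong) (auto simp: d_def algebra_simps)
    then show ?thesis
      using F G by (simp add: sum.inter_restrict[symmetric] Int_absorb1)
  qed
  then show ?thesis
    unfolding trig_poly_def using F(1) G(1)
    by (intro exI[of _ "F \<union> G"] exI[of _ d]) auto
qed

lemma trig_poly_mult:
  assumes "trig_poly p" "trig_poly r"
  shows "trig_poly (\<lambda>t. p t * r t)"
proof -
  obtain F a where F: "finite F" "p = (\<lambda>t. \<Sum>k\<in>F. a k * torus_char k t)"
    using assms by (auto simp: trig_poly_def)
  have "trig_poly (\<lambda>t. (\<Sum>k\<in>F. a k * torus_char k t) * r t)"
    using F(1)
  proof (induction F)
    case empty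
    then show ?case using trig_poly_const[of 0] by simp
  next
    case (insert l F)
    then show ?case
      using trig_poly_add[OF trig_poly_cmult_char[OF assms(2), of "a l" l] insert.IH]
      by (simp add: distrib_right)
  qed
  then show ?thesis by (simp add: F)
qed

lemma trig_poly_prod:
  assumes "finite I" "\<And>i. i \<in> I \<Longrightarrow> trig_poly (p i)"
  shows "trig_poly (\<lambda>t. \<Prod>i\<in>I. p i t)"
  using assms by (induction I) (auto intro: trig_poly_const trig_poly_mult)

lemma trig_poly_power: "trig_poly p \<Longrightarrow> trig_poly (\<lambda>t. p t ^ n)"
  by (induction n) (auto intro: trig_poly_const trig_poly_mult)

text \<open>
  Orthogonality turns the mean of \<open>h * p\<close> into a finite sum of products of coefficients of \<open>p\<close>
  and of \<open>h\<close>. The former are all at most the mean of a majorant \<open>r\<close> of \<open>\<bar>p\<bar>\<close>, whatever the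
  degree of \<open>p\<close> may be, and the latter sum to at most \<open>S\<close>.
\<close>

lemma norm_torus_mean_trig_poly_le:
  fixes h :: "real^'m \<Rightarrow> complex"
  assumes h: "continuous_on UNIV h"
    and S: "\<And>F. finite F \<Longrightarrow> (\<Sum>k\<in>F. cmod (torus_mean (\<lambda>t. h t * torus_char (- k) t))) \<le> S"
    and p: "trig_poly p" and r: "continuous_on UNIV r" "\<And>t. cmod (p t) \<le> r t"
  shows "cmod (torus_mean (\<lambda>t. h t * p t)) \<le> S * torus_mean r"
proof -
  let ?c = "\<lambda>k. torus_mean (\<lambda>t. h t * torus_char (- k) t)"
  obtain F a where F: "finite F" "p = (\<lambda>t. \<Sum>k\<in>F. a k * torus_char k t)"
    using p by (auto simp: trig_poly_def)
  have cont: "continuous_on UNIV p"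
    unfolding F by (intro continuous_intros continuous_torus_char)
  have a: "cmod (a l) \<le> torus_mean r" if "l \<in> F" for l
  proof -
    have "torus_mean (\<lambda>t. p t * torus_char (- l) t) = torus_mean (\<lambda>t. \<Sum>k\<in>F. a k * torus_char (k - l) t)"
      by (simp add: F sum_distrib_right mult.assoc torus_char_add[of _ "- l", simplified])
    also have "\<dots> = (\<Sum>k\<in>F. a k * torus_mean (torus_char (k - l)))"
      using F(1) by (subst torus_mean_sum)
        (auto intro!: continuous_intros continuous_torus_char simp: torus_mean_mult_left)
    also have "\<dots> = (\<Sum>k\<in>F. if k = l then a k else 0)"
      by (intro sum.cong) (auto simp: torus_mean_char)
    also have "\<dots> = a l" using that F(1) by simp
    finally have "a l = torus_mean (\<lambda>t. p t * torus_char (- l) t)" by simp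
    also have "cmod \<dots> \<le> torus_mean r"
      using cont r by (intro norm_torus_mean_le) (auto intro!: continuous_intros continuous_torus_char simp: norm_mult)
    finally show ?thesis .
  qed
  have "torus_mean (\<lambda>t. h t * p t) = torus_mean (\<lambda>t. \<Sum>k\<in>F. a k * (h t * torus_char k t))"
    by (simp add: F sum_distrib_left mult_ac)
  also have "\<dots> = (\<Sum>k\<in>F. a k * ?c (- k))"
    using F(1) h by (subst torus_mean_sum)
      (auto intro!: continuous_intros continuous_torus_char simp: torus_mean_mult_left)
  also have "cmod \<dots> \<le> (\<Sum>k\<in>F. torus_mean r * cmod (?c (- k)))"
    by (rule sum_norm_le) (auto simp: norm_mult intro!: mult_right_mono a)
  also have "\<dots> = torus_mean r * (\<Sum>k\<in>uminus ` F. cmod (?c k))"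
    by (subst sum.reindex) (auto simp: sum_distrib_left inj_on_def)
  also have "\<dots> \<le> torus_mean r * S"
  proof (rule mult_left_mono)
    show "(\<Sum>k\<in>uminus ` F. cmod (?c k)) \<le> S" using F(1) by (intro S) auto
    show "0 \<le> torus_mean r"
      using norm_torus_mean_le[OF cont r] norm_ge_zero order_trans by blast
  qed
  finally show ?thesis by (simp add: mult.commute)
qed

text \<open>
  A nonnegative trigonometric polynomial whose maximum \<open>1\<close> over the cell is attained only at the
  centre \<open>(pi, ..., pi)\<close>. With the peak in the interior of the cell, no neighbourhood of it has
  to be wrapped around the boundary.
\<close>

definition peak :: "real^'m \<Rightarrow> real" where
  "peak t = (\<Prod>i\<in>UNIV. (1 - cos (t $ i)) / 2)"

lemma trig_poly_peak: "trig_poly (\<lambda>t. complex_of_real (peak t))"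
proof -
  have "complex_of_real ((1 - cos (t $ i)) / 2) =
      1 / 2 + (- 1 / 4) * torus_char (axis i 1) t * 1 + (- 1 / 4) * torus_char (- axis i 1) t * 1" for t :: "real^'a" and i
    by (simp add: torus_char_def inner_axis' complex_eq_iff)
  then have "trig_poly (\<lambda>t::real^'a. complex_of_real ((1 - cos (t $ i)) / 2))" for i
    by (simp only:) (intro trig_poly_add trig_poly_cmult_char trig_poly_const)
  then show ?thesis
    unfolding peak_def of_real_prod by (intro trig_poly_prod) auto
qed

lemma peak_bounds: "0 \<le> peak t" "peak t \<le> 1"
  unfolding peak_def by (auto intro!: prod_nonneg prod_le_1)

lemma continuous_peak: "continuous_on A peak"
  unfolding peak_def by (intro continuous_intros) auto

lemma peak_less_1:
  assumes "t \<in> torus_cell" "t \<noteq> (\<chi> i. pi)"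
  shows "peak t < 1"
proof -
  obtain i where i: "t $ i \<noteq> pi" using assms(2) by (auto simp: vec_eq_iff)
  have t: "0 \<le> t $ i" "t $ i \<le> 2 * pi"
    using assms(1) by (auto simp: torus_cell_def mem_box_cart)
  have "cos (t $ i) \<noteq> -1"
  proof
    assume "cos (t $ i) = -1"
    then obtain n :: int where n: "t $ i = (2 * n + 1) * pi"
      by (auto simp: cos_eq_minus1)
    have "0 \<le> 2 * real_of_int n + 1" "2 * real_of_int n + 1 \<le> 2"
      using t pi_gt_zero unfolding n by (auto simp: zero_le_mult_iff simp del: pi_gt_zero)
    then have "n = 0" by linarith
    with n i show False by simp
  qed
  then have "cos (t $ i) > -1" using cos_ge_minus_one[of "t $ i"] by linarith
  have "peak t = (1 - cos (t $ i)) / 2 * (\<Prod>i\<in>UNIV - {i}. (1 - cos (t $ i)) / 2)"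
    unfolding peak_def by (rule prod.remove) auto
  also have "\<dots> \<le> (1 - cos (t $ i)) / 2 * 1"
    by (intro mult_left_mono prod_le_1) auto
  finally show ?thesis using \<open>cos (t $ i) > -1\<close> by simp
qed

text \<open>
  The powers of \<open>peak\<close> are an approximate identity at the centre (up to normalisation). If \<open>\<bar>h\<bar>\<close>
  exceeded \<open>S\<close> there, then, after rotating \<open>h\<close> by a unimodular constant, the real function
  \<open>w = Re (u * h) - S\<close> would be positive near the centre while its means against \<open>peak ^ n\<close> are
  nonpositive. But near the centre \<open>peak ^ n\<close> is at least \<open>r' ^ n\<close>, and where \<open>w\<close> may be
  negative it is at most \<open>r ^ n\<close> with \<open>r < r'\<close>, so for large \<open>n\<close> the positive part would win.
\<close>

lemma norm_peak_point_le:
  fixes h :: "real^'m \<Rightarrow> complex"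
  assumes h: "continuous_on UNIV h"
    and S: "\<And>n. cmod (torus_mean (\<lambda>t. h t * of_real (peak t ^ n))) \<le> S * torus_mean (\<lambda>t::real^'m. peak t ^ n)"
  shows "cmod (h (\<chi> i. pi)) \<le> S"
proof (rule ccontr)
  define c :: "real^'m" where "c = (\<chi> i. pi)"
  assume "\<not> cmod (h (\<chi> i. pi)) \<le> S"
  then have gt: "cmod (h c) > S" by (simp add: c_def)
  define u where "u = cnj (sgn (h c))"
  define w where "w t = Re (u * h t) - S" for t
  define \<delta> where "\<delta> = (cmod (h c) - S) / 2"
  have u: "cmod u \<le> 1" by (simp add: u_def norm_sgn)
  have "u * h c = cmod (h c)"
    by (cases "h c = 0") (simp_all add: u_def sgn_eq complex_norm_square[symmetric] power2_eq_square mult.commute[of "cnj _"])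
  then have wc: "w c = 2 * \<delta>" by (simp add: w_def \<delta>_def)
  have \<delta>: "\<delta> > 0" using gt by (simp add: \<delta>_def)
  have w_cont: "continuous_on A w" for A
    unfolding w_def using continuous_on_subset[OF h, of A] by (intro continuous_intros) auto
  have le0: "integral torus_cell (\<lambda>t. w t * peak t ^ n) \<le> 0" for n
  proof -
    have "torus_mean (\<lambda>t. w t * peak t ^ n) =
        torus_mean (\<lambda>t. Re (u * (h t * of_real (peak t ^ n))) + (- S) * peak t ^ n)"
      by (simp add: w_def algebra_simps)
    also have "\<dots> = torus_mean (\<lambda>t. Re (u * (h t * of_real (peak t ^ n)))) + torus_mean (\<lambda>t::real^'m. (- S) * peak t ^ n)"
      by (rule torus_mean_add) (intro continuous_intros continuous_peak h)+
    also have "torus_mean (\<lambda>t::real^'m. (- S) * peak t ^ n) = - S * torus_mean (\<lambda>t::real^'m. peak t ^ n)"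
      by (simp add: torus_mean_def)
    also have "torus_mean (\<lambda>t. Re (u * (h t * of_real (peak t ^ n)))) =
        Re (torus_mean (\<lambda>t. u * (h t * of_real (peak t ^ n))))"
    proof -
      have "(\<lambda>t. u * (h t * of_real (peak t ^ n))) integrable_on torus_cell"
        by (intro integrable_torus_cell continuous_intros continuous_peak h)
      from integral_linear[OF this bounded_linear_Re] show ?thesis
        by (simp add: torus_mean_def o_def)
    qed
    also have "\<dots> \<le> cmod (torus_mean (\<lambda>t. h t * of_real (peak t ^ n)))"
      using mult_right_mono[OF u] unfolding torus_mean_mult_left
      by (intro order_trans[OF complex_Re_le_cmod]) (auto simp: norm_mult)
    finally have "torus_mean (\<lambda>t. w t * peak t ^ n) \<le> 0" using S[of n] by simp
    moreover have "inverse ((2 * pi) ^ CARD('m)) > 0" by simp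
    ultimately show ?thesis
      unfolding torus_mean_def real_scaleR_def by (metis mult_pos_pos not_le)
  qed
  \<comment> \<open>A negative contribution to the integral can only come from outside \<open>U\<close>, where \<open>peak\<close> is bounded away from \<open>1\<close>.\<close>
  define U where "U = {t. w t > \<delta>}"
  have U: "open U" "c \<in> U"
    unfolding U_def using w_cont[of UNIV] wc \<delta> by (auto intro!: open_Collect_less continuous_intros)
  have cell: "compact (torus_cell :: (real^'m) set)" by (simp add: torus_cell_def)
  obtain r where r: "0 \<le> r" "r < 1" "\<And>t. t \<in> torus_cell - U \<Longrightarrow> peak t \<le> r"
  proof (cases "torus_cell - U = {}")
    case True
    then show ?thesis using that[of 0] by auto
  next
    case False
    have "compact (torus_cell - U)" using cell U by (simp add: compact_diff)
    from continuous_attains_sup[OF this False continuous_peak] obtain s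
      where "s \<in> torus_cell - U" "\<And>t. t \<in> torus_cell - U \<Longrightarrow> peak t \<le> peak s" by blast
    then show ?thesis using that[of "peak s"] peak_less_1[of s] peak_bounds[of s] U
      by (auto simp: c_def)
  qed
  define r' where "r' = (1 + r) / 2"
  have r': "r < r'" "0 < r'" "r' < 1" using r by (auto simp: r'_def)
  \<comment> \<open>A box inside \<open>V\<close> carries enough positive mass to beat the complement of \<open>U\<close>.\<close>
  define V where "V = U \<inter> {t. peak t > r'} \<inter> box 0 (\<chi> i. 2 * pi)"
  have "peak c = 1" by (simp add: peak_def c_def)
  then have V: "open V" "c \<in> V"
    unfolding V_def using U r' by (auto intro!: open_Int open_Collect_less continuous_intros continuous_peak simp: mem_box_cart c_def)
  obtain a b where ab: "cbox a b \<subseteq> V" "\<forall>i\<in>Basis. a \<bullet> i < b \<bullet> i"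
    using open_contains_cbox[OF V] by metis
  have ab_cell: "cbox a b \<subseteq> torus_cell"
    using ab(1) box_subset_cbox unfolding V_def torus_cell_def by blast
  have vol: "measure lborel (cbox a b) > 0"
    using ab(2) by (subst content_pos_lt_eq) auto
  have "bounded (w ` torus_cell)"
    using compact_continuous_image[OF w_cont cell] compact_imp_bounded by blast
  then obtain M where M: "M > 0" "\<And>t. t \<in> torus_cell \<Longrightarrow> \<bar>w t\<bar> \<le> M"
    unfolding bounded_pos by auto
  define L where "L = measure lborel (torus_cell :: (real^'m) set)"
  have L: "L > 0" by (simp add: L_def content_torus_cell)
  have key: "\<delta> * r' ^ n * measure lborel (cbox a b) \<le> M * r ^ n * L" for n
  proof -
    have 1: "((\<lambda>t. if t \<in> cbox a b then \<delta> * r' ^ n else 0) has_integral \<delta> * r' ^ n * measure lborel (cbox a b)) torus_cell"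
      using has_integral_restrict[OF ab_cell, of "\<lambda>t. \<delta> * r' ^ n"] has_integral_const[of "\<delta> * r' ^ n" a b]
      by (simp add: mult.commute)
    have 2: "((\<lambda>t::real^'m. M * r ^ n) has_integral M * r ^ n * L) torus_cell"
      using has_integral_const[of "M * r ^ n" "0::real^'m" "\<chi> i. 2 * pi"]
      by (simp add: L_def torus_cell_def mult.commute)
    have 3: "((\<lambda>t. w t * peak t ^ n) has_integral integral torus_cell (\<lambda>t. w t * peak t ^ n)) torus_cell"
      by (intro integrable_integral integrable_torus_cell continuous_intros w_cont continuous_peak)
    have "(if t \<in> cbox a b then \<delta> * r' ^ n else 0) - M * r ^ n \<le> w t * peak t ^ n" if t: "t \<in> torus_cell" for t
    proof -
      have rn: "0 \<le> M * r ^ n" using M r by auto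
      consider "t \<in> cbox a b" | "t \<notin> cbox a b" "t \<in> U" | "t \<notin> cbox a b" "t \<notin> U" by blast
      then show ?thesis
      proof cases
        case 1
        then have "t \<in> V" using ab by blast
        then have "\<delta> * r' ^ n \<le> w t * peak t ^ n"
          using r' \<delta> by (intro mult_mono power_mono) (auto simp: V_def U_def)
        then show ?thesis using 1 rn by simp
      next
        case 2
        then have "0 \<le> w t * peak t ^ n"
          using \<delta> peak_bounds(1)[of t] by (intro mult_nonneg_nonneg) (auto simp: U_def)
        then show ?thesis using 2 rn by simp
      next
        case 3
        have "\<bar>w t * peak t ^ n\<bar> \<le> M * r ^ n"
          unfolding abs_mult power_abs using 3 t M r peak_bounds(1)[of t]
          by (intro mult_mono power_mono) auto
        then show ?thesis using 3 by simp
      qed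
    qed
    from has_integral_le[OF has_integral_diff[OF 1 2] 3 this] le0[of n] show ?thesis by simp
  qed
  have "(\<lambda>n. M * L * (r / r') ^ n) \<longlonglongrightarrow> M * L * 0"
    using r r' by (intro tendsto_mult tendsto_const LIMSEQ_realpow_zero) auto
  moreover have "\<delta> * measure lborel (cbox a b) \<le> M * L * (r / r') ^ n" for n
    using key[of n] r' by (simp add: power_divide field_simps)
  ultimately have "\<delta> * measure lborel (cbox a b) \<le> 0"
    by (intro LIMSEQ_le_const) auto
  then show False using \<delta> vol by (simp add: mult_le_0_iff)
qed

text \<open>
  The step from coefficients back to the function: the bound \<open>\<bar>h\<bar> \<le> \<Sum>\<bar>c_k\<bar>\<close> follows from the
  bound at the centre of the cell, applied to a translate of \<open>h\<close>.
\<close>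

lemma norm_le_sum_fourier_coeffs:
  fixes h :: "real^'m \<Rightarrow> complex"
  assumes h: "continuous_on UNIV h" "periodic h"
    and S: "\<And>F. finite F \<Longrightarrow> (\<Sum>k\<in>F. cmod (torus_mean (\<lambda>t. h t * torus_char (- k) t))) \<le> S"
  shows "cmod (h t) \<le> S"
proof -
  define a where "a = t - (\<chi> i. pi)"
  have "cmod (h ((\<chi> i. pi) + a)) \<le> S"
  proof (rule norm_peak_point_le[of "\<lambda>t. h (t + a)"])
    show cont: "continuous_on UNIV (\<lambda>t. h (t + a))" by (rule continuous_on_shift[OF h(1)])
    have S': "(\<Sum>k\<in>F. cmod (torus_mean (\<lambda>t. h (t + a) * torus_char (- k) t))) \<le> S" if "finite F" for F
      using S[OF that] h by (simp add: torus_coeff_shift norm_mult)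
    show "cmod (torus_mean (\<lambda>t. h (t + a) * of_real (peak t ^ n))) \<le> S * torus_mean (\<lambda>t::real^'m. peak t ^ n)" for n
    proof (rule norm_torus_mean_trig_poly_le[where h = "\<lambda>t. h (t + a)" and p = "\<lambda>t. of_real (peak t ^ n)"])
      show "trig_poly (\<lambda>t::real^'m. complex_of_real (peak t ^ n))"
        unfolding of_real_power by (intro trig_poly_power trig_poly_peak)
      show "continuous_on UNIV (\<lambda>t::real^'m. peak t ^ n)"
        by (intro continuous_intros continuous_peak)
      show "cmod (complex_of_real (peak t ^ n)) \<le> peak t ^ n" for t :: "real^'m"
        using peak_bounds(1)[of t] by (simp add: norm_power)
    qed (use cont S' in auto)
  qed
  then show ?thesis by (simp add: a_def)
qed

section \<open>Fourier coefficients of derivatives\<close>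

lemma C_infinity_continuous: "C_infinity f \<Longrightarrow> continuous_on A f"
  unfolding C_infinity_def by (elim allE[of _ "[]"]) (auto intro: continuous_on_subset)

lemma C_infinity_partial_deriv:
  assumes "C_infinity f" "v \<in> Basis"
  shows "C_infinity (partial_deriv v f)"
  unfolding C_infinity_def
proof (intro allI impI)
  fix vs :: "'a list"
  assume "set vs \<subseteq> Basis"
  then have "set (vs @ [v]) \<subseteq> Basis" using assms(2) by simp
  with assms(1) have "continuous_on UNIV (foldr partial_deriv (vs @ [v]) f) \<and>
      (\<forall>w\<in>Basis. \<forall>z. (\<lambda>s. foldr partial_deriv (vs @ [v]) f (z + s *\<^sub>R w)) differentiable (at 0))"
    unfolding C_infinity_def by blast
  then show "continuous_on UNIV (foldr partial_deriv vs (partial_deriv v f)) \<and>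
      (\<forall>w\<in>Basis. \<forall>z. (\<lambda>s. foldr partial_deriv vs (partial_deriv v f) (z + s *\<^sub>R w)) differentiable (at 0))"
    by simp
qed

lemma C_infinity_has_vector_derivative:
  assumes "C_infinity f" "v \<in> Basis"
  shows "((\<lambda>s. f (z + s *\<^sub>R v)) has_vector_derivative partial_deriv v f (z + s *\<^sub>R v)) (at s)"
proof -
  have "(\<lambda>r. f ((z + s *\<^sub>R v) + r *\<^sub>R v)) differentiable (at 0)"
    using assms unfolding C_infinity_def by (auto dest: spec[of _ "[]"])
  then have 1: "((\<lambda>r. f ((z + s *\<^sub>R v) + r *\<^sub>R v)) has_vector_derivative partial_deriv v f (z + s *\<^sub>R v)) (at (s - s))"
    by (simp add: partial_deriv_def vector_derivative_works)
  have "((\<lambda>r. r - s) has_vector_derivative 1) (at s)"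
    by (auto intro!: derivative_eq_intros)
  from vector_diff_chain_at[OF this 1] show ?thesis
    by (simp add: o_def algebra_simps)
qed

text \<open>
  Differentiation under the integral sign over the compact cell; it serves for derivatives in
  \<open>x\<close> and, through translations, for those in \<open>t\<close>.
\<close>

lemma torus_mean_has_vector_derivative:
  fixes F :: "real \<Rightarrow> real^'m \<Rightarrow> complex"
  assumes F: "\<And>s t. ((\<lambda>s. F s t) has_vector_derivative F' s t) (at s)"
    and cont: "\<And>s. continuous_on UNIV (F s)" "continuous_on UNIV (\<lambda>(s, t). F' s t)"
  shows "((\<lambda>s. torus_mean (F s)) has_vector_derivative torus_mean (F' s)) (at s)"
proof -
  have "((\<lambda>s. integral torus_cell (F s)) has_vector_derivative integral torus_cell (F' s)) (at s within UNIV)"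
    unfolding torus_cell_def
  proof (rule leibniz_rule_vector_derivative)
    show "F s integrable_on cbox 0 (\<chi> i. 2 * pi)" for s
      using integrable_torus_cell[OF cont(1)] by (simp add: torus_cell_def)
    show "continuous_on (UNIV \<times> cbox 0 (\<chi> i. 2 * pi)) (\<lambda>(s, t). F' s t)"
      by (rule continuous_on_subset[OF cont(2)]) simp
  qed (use F in auto)
  then show ?thesis
    unfolding torus_mean_def by (auto intro: bounded_linear.has_vector_derivative[OF bounded_linear_scaleR_right])
qed

lemma torus_fourier_eq_torus_mean:
  fixes f :: "(real^'m) \<times> (real^'n) \<Rightarrow> complex"
  assumes "continuous_on UNIV f"
  shows "torus_fourier f k x = torus_mean (\<lambda>t. f (t, x) * torus_char (- k) t)"
proof -
  have exp: "exp (- \<i> * of_real (real_vec k \<bullet> t)) = torus_char (- k) t" for t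
    by (simp add: torus_char_def cis_conv_exp)
  have "continuous_on torus_cell (\<lambda>t. f (t, x) * torus_char (- k) t)"
    by (intro continuous_intros continuous_torus_char continuous_on_compose2[OF assms]) auto
  then have "set_integrable lborel torus_cell (\<lambda>t. f (t, x) * torus_char (- k) t)"
    unfolding set_integrable_def by (intro borel_integrable_compact) (simp_all add: torus_cell_def)
  from set_borel_integral_eq_integral(2)[OF this] show ?thesis
    unfolding torus_fourier_def exp torus_mean_def by (simp add: scaleR_conv_of_real field_simps)
qed

lemma smooth_torus_C_infinity: "f \<in> smooth_torus \<Longrightarrow> C_infinity f"
  by (simp add: smooth_torus_def)

lemma continuous_on_smooth_slice:
  "f \<in> smooth_torus \<Longrightarrow> continuous_on A (\<lambda>t. f (t, x))"
  by (rule continuous_on_compose2[OF C_infinity_continuous[of f UNIV]])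
    (auto simp: smooth_torus_def intro!: continuous_intros)

lemma periodic_smooth_slice: "f \<in> smooth_torus \<Longrightarrow> periodic (\<lambda>t. f (t, x))"
  by (simp add: smooth_torus_def torus_periodic_def periodic_def)

text \<open>
  Closure of the periodic smooth functions under single derivatives is what makes the inductions
  over multi-indices below work.
\<close>

lemma smooth_torus_partial_deriv:
  assumes "f \<in> smooth_torus" "v \<in> Basis"
  shows "partial_deriv v f \<in> smooth_torus"
proof -
  have per: "f (z + (axis i (2 * pi), 0)) = f z" for z i
    using assms(1) by (cases z) (simp add: smooth_torus_def torus_periodic_def)
  have "f ((t + axis i (2 * pi), x) + s *\<^sub>R v) = f ((t, x) + s *\<^sub>R v)" for t x s i
    using per[of "(t, x) + s *\<^sub>R v" i] by (cases v) (simp add: ac_simps)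
  then have "torus_periodic (partial_deriv v f)"
    by (simp add: torus_periodic_def partial_deriv_def)
  then show ?thesis
    using assms C_infinity_partial_deriv by (auto simp: smooth_torus_def)
qed

lemma partial_deriv_torus_fourier:
  fixes f :: "(real^'m) \<times> (real^'n) \<Rightarrow> complex"
  assumes f: "f \<in> smooth_torus" and v: "v \<in> Basis"
  shows "partial_deriv v (torus_fourier f k) = torus_fourier (partial_deriv (0, v) f) k"
proof
  fix x
  let ?w = "(0, v) :: (real^'m) \<times> (real^'n)"
  have w: "?w \<in> Basis" using v by (simp add: Basis_prod_def)
  note f' = smooth_torus_partial_deriv[OF f w]
  have "((\<lambda>s. torus_mean (\<lambda>t. f (t, x + s *\<^sub>R v) * torus_char (- k) t)) has_vector_derivative
      torus_mean (\<lambda>t. partial_deriv ?w f (t, x + 0 *\<^sub>R v) * torus_char (- k) t)) (at 0)"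
  proof (rule torus_mean_has_vector_derivative)
    show "((\<lambda>s. f (t, x + s *\<^sub>R v) * torus_char (- k) t) has_vector_derivative
        partial_deriv ?w f (t, x + s *\<^sub>R v) * torus_char (- k) t) (at s)" for s t
      using C_infinity_has_vector_derivative[OF smooth_torus_C_infinity[OF f] w, of "(t, x)" s]
      by (intro has_vector_derivative_mult_left) simp
    show "continuous_on UNIV (\<lambda>t. f (t, x + s *\<^sub>R v) * torus_char (- k) t)" for s
      by (intro continuous_intros continuous_torus_char continuous_on_smooth_slice f)
    show "continuous_on UNIV (\<lambda>(s, t). partial_deriv ?w f (t, x + s *\<^sub>R v) * torus_char (- k) t)"
      unfolding case_prod_beta
      by (intro continuous_intros continuous_on_compose2[OF continuous_torus_char[of UNIV]]
          continuous_on_compose2[OF C_infinity_continuous[OF smooth_torus_C_infinity[OF f'], of UNIV]]) auto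
  qed
  then show "partial_deriv v (torus_fourier f k) x = torus_fourier (partial_deriv ?w f) k x"
    using C_infinity_continuous[OF smooth_torus_C_infinity[OF f]] C_infinity_continuous[OF smooth_torus_C_infinity[OF f']]
    by (simp add: partial_deriv_def[of v] torus_fourier_eq_torus_mean vector_derivative_at)
qed

text \<open>
  Translating \<open>f\<close> by \<open>s\<close> in the \<open>i\<close>-th torus variable multiplies its \<open>k\<close>-th coefficient by
  \<open>cis (s * k_i)\<close>. Both sides are differentiated in \<open>s\<close> at \<open>0\<close>.
\<close>

lemma torus_fourier_partial_deriv:
  fixes f :: "(real^'m) \<times> (real^'n) \<Rightarrow> complex"
  assumes f: "f \<in> smooth_torus"
  shows "torus_fourier (partial_deriv (axis i 1, 0) f) k x = \<i> * of_int (k $ i) * torus_fourier f k x"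
proof -
  let ?w = "(axis i 1, 0) :: (real^'m) \<times> (real^'n)"
  have w: "?w \<in> Basis" by (simp add: Basis_prod_def)
  note f' = smooth_torus_partial_deriv[OF f w]
  have "((\<lambda>s. torus_mean (\<lambda>t. f (t + s *\<^sub>R axis i 1, x) * torus_char (- k) t)) has_vector_derivative
      torus_mean (\<lambda>t. partial_deriv ?w f (t + 0 *\<^sub>R axis i 1, x) * torus_char (- k) t)) (at 0)"
  proof (rule torus_mean_has_vector_derivative)
    show "((\<lambda>s. f (t + s *\<^sub>R axis i 1, x) * torus_char (- k) t) has_vector_derivative
        partial_deriv ?w f (t + s *\<^sub>R axis i 1, x) * torus_char (- k) t) (at s)" for s t
      using C_infinity_has_vector_derivative[OF smooth_torus_C_infinity[OF f] w, of "(t, x)" s]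
      by (intro has_vector_derivative_mult_left) simp
    show "continuous_on UNIV (\<lambda>t. f (t + s *\<^sub>R axis i 1, x) * torus_char (- k) t)" for s
      using continuous_on_shift[OF continuous_on_smooth_slice[OF f]]
      by (intro continuous_intros continuous_torus_char)
    show "continuous_on UNIV (\<lambda>(s, t). partial_deriv ?w f (t + s *\<^sub>R axis i 1, x) * torus_char (- k) t)"
      unfolding case_prod_beta
      by (intro continuous_intros continuous_on_compose2[OF continuous_torus_char[of UNIV]]
          continuous_on_compose2[OF C_infinity_continuous[OF smooth_torus_C_infinity[OF f'], of UNIV]]) auto
  qed
  moreover have "torus_mean (\<lambda>t. f (t + s *\<^sub>R axis i 1, x) * torus_char (- k) t) =
      cis (s * of_int (k $ i)) * torus_fourier f k x" for s
    using torus_coeff_shift[OF continuous_on_smooth_slice[OF f] periodic_smooth_slice[OF f]]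
      C_infinity_continuous[OF smooth_torus_C_infinity[OF f]]
    by (simp add: torus_fourier_eq_torus_mean torus_char_def inner_axis)
  moreover have "((\<lambda>s. cis (s * of_int (k $ i)) * torus_fourier f k x) has_vector_derivative
      \<i> * of_int (k $ i) * torus_fourier f k x) (at 0)"
    using has_vector_derivative_mult_left[OF
        exp_scaleR_has_vector_derivative_left[of "\<i> * of_int (k $ i)" 0], of "torus_fourier f k x"]
    by (simp add: cis_conv_exp scaleR_conv_of_real mult_ac)
  ultimately show ?thesis
    using C_infinity_continuous[OF smooth_torus_C_infinity[OF f']]
    by (simp add: torus_fourier_eq_torus_mean vector_derivative_unique_at)
qed

text \<open>
  If \<open>T\<close> intertwines single derivatives \<open>D i\<close> with operators \<open>E i\<close>, it intertwines multi-index
  derivatives, which are the iterated folds below. The enumeration of the index type is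
  arbitrary; what matters is that both sides run through it in the same order.
\<close>

lemma foldr_funpow_commute:
  assumes "\<And>i f. f \<in> A \<Longrightarrow> D i f \<in> A" "\<And>i f. f \<in> A \<Longrightarrow> T (D i f) = E i (T f)" "f \<in> A"
  shows "foldr (\<lambda>i. D i ^^ a i) is f \<in> A"
    and "T (foldr (\<lambda>i. D i ^^ a i) is f) = foldr (\<lambda>i. E i ^^ a i) is (T f)"
proof -
  have pow: "(D i ^^ n) g \<in> A \<and> T ((D i ^^ n) g) = (E i ^^ n) (T g)" if "g \<in> A" for g i n
    using that assms(1,2) by (induction n) auto
  have "foldr (\<lambda>i. D i ^^ a i) is f \<in> A \<and>
      T (foldr (\<lambda>i. D i ^^ a i) is f) = foldr (\<lambda>i. E i ^^ a i) is (T f)"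
    using assms(3) pow by (induction "is") auto
  then show "foldr (\<lambda>i. D i ^^ a i) is f \<in> A"
    "T (foldr (\<lambda>i. D i ^^ a i) is f) = foldr (\<lambda>i. E i ^^ a i) is (T f)" by auto
qed

lemma smooth_torus_multi_deriv:
  assumes "f \<in> smooth_torus" "\<And>i. e i \<in> Basis"
  shows "multi_deriv e \<alpha> f \<in> smooth_torus"
  unfolding multi_deriv_def
  \<comment> \<open>Only the invariance of the set is of interest here, so \<open>T\<close> is taken to be trivial.\<close>
  by (rule foldr_funpow_commute(1)[where T = "\<lambda>_. ()" and E = "\<lambda>_ _. ()"])
    (use assms in \<open>auto simp del: split_paired_All intro: smooth_torus_partial_deriv\<close>)

lemma deriv_vec_torus_fourier:
  assumes "f \<in> smooth_torus"
  shows "deriv_vec \<beta> (torus_fourier f k) = torus_fourier (deriv_x \<beta> f) k"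
  unfolding multi_deriv_def
  by (rule foldr_funpow_commute(2)[symmetric, where A = smooth_torus and T = "\<lambda>f. torus_fourier f k"])
    (use assms in \<open>auto intro!: smooth_torus_partial_deriv simp: partial_deriv_torus_fourier Basis_prod_def\<close>)

lemma torus_fourier_deriv_t:
  assumes "f \<in> smooth_torus"
  shows "torus_fourier (deriv_t \<alpha> f) k x = (\<Prod>i\<in>UNIV. (\<i> * of_int (k $ i)) ^ (\<alpha> $ i)) * torus_fourier f k x"
proof -
  have pow: "((\<lambda>z. c * z) ^^ n) z = c ^ n * z" for c z :: complex and n
    by (induction n) auto
  have "torus_fourier (deriv_t \<alpha> f) k x =
      foldr (\<lambda>i. (\<lambda>z. \<i> * of_int (k $ i) * z) ^^ (\<alpha> $ i)) index_enum (torus_fourier f k x)"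
    unfolding multi_deriv_def
    by (rule foldr_funpow_commute(2)[where A = smooth_torus and T = "\<lambda>f. torus_fourier f k x"])
      (use assms in \<open>auto intro!: smooth_torus_partial_deriv simp: torus_fourier_partial_deriv Basis_prod_def\<close>)
  also have "\<dots> = (\<Prod>i\<leftarrow>index_enum. (\<i> * of_int (k $ i)) ^ (\<alpha> $ i)) * torus_fourier f k x"
  proof -
    have "foldr (\<lambda>i. (\<lambda>z. \<i> * of_int (k $ i) * z) ^^ (\<alpha> $ i)) is z =
        (\<Prod>i\<leftarrow>is. (\<i> * of_int (k $ i)) ^ (\<alpha> $ i)) * z" for "is" z
      by (induction "is") (simp_all add: pow mult.assoc[symmetric])
    then show ?thesis .
  qed
  also have "(\<Prod>i\<leftarrow>index_enum. (\<i> * of_int (k $ i)) ^ (\<alpha> $ i)) = (\<Prod>i\<in>UNIV. (\<i> * of_int (k $ i)) ^ (\<alpha> $ i))"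
    using prod.distinct_set_conv_list[OF index_enum(1)] index_enum(2) by metis
  finally show ?thesis .
qed

section \<open>Lattice sums and polynomial weights\<close>

lemma norm_square_vec: "(norm (x::real^'n))\<^sup>2 = (\<Sum>j\<in>UNIV. (x $ j)\<^sup>2)"
  unfolding power2_norm_eq_inner by (simp add: inner_vec_def power2_eq_square)

lemma square_component_le: "(x $ j)\<^sup>2 \<le> (norm (x::real^'n))\<^sup>2"
  unfolding norm_square_vec by (intro member_le_sum) auto

text \<open>
  The comparison \<open>1 / (1 + N\<^sup>2) \<le> 1 / (N - 1/2) - 1 / (N + 1/2)\<close> telescopes; each \<open>N > 0\<close> occurs
  with both signs. The symmetric partial sums are therefore at most \<open>1 + 2 * 2\<close>.
\<close>

lemma sum_inverse_square_int_le:
  assumes "finite J"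
  shows "(\<Sum>j\<in>J. 1 / (1 + (real_of_int j)\<^sup>2)) \<le> 5"
proof -
  have le: "(\<Sum>j\<in>{- int n..int n}. 1 / (1 + (real_of_int j)\<^sup>2)) \<le> 5 - 2 / (real n + 1/2)" for n
  proof (induction n)
    case (Suc n)
    have "{- int (Suc n)..int (Suc n)} = insert (int (Suc n)) (insert (- int (Suc n)) {- int n..int n})"
      by auto
    then have "(\<Sum>j\<in>{- int (Suc n)..int (Suc n)}. 1 / (1 + (real_of_int j)\<^sup>2)) =
        2 / (1 + (real n + 1)\<^sup>2) + (\<Sum>j\<in>{- int n..int n}. 1 / (1 + (real_of_int j)\<^sup>2))"
      by (simp add: power2_eq_square algebra_simps)
    also have "2 / (1 + (real n + 1)\<^sup>2) \<le> 2 / (real n + 1/2) - 2 / (real (Suc n) + 1/2)"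
    proof -
      have "2 / (real n + 1/2) - 2 / (real (Suc n) + 1/2) = 2 / ((real n + 1/2) * (real n + 3/2))"
        by (simp add: field_simps)
      also have "\<dots> \<ge> 2 / (1 + (real n + 1)\<^sup>2)"
        by (intro divide_left_mono) (auto simp: power2_eq_square algebra_simps intro!: mult_pos_pos add_pos_nonneg)
      finally show ?thesis .
    qed
    finally show ?case using Suc by simp
  qed simp
  define n where "n = nat (Max (insert 0 (abs ` J)))"
  have "\<bar>j\<bar> \<le> int n" if "j \<in> J" for j
    unfolding n_def using assms that by (auto intro!: Max_ge simp: Max_ge_iff)
  then have "J \<subseteq> {- int n..int n}" by (force simp: abs_le_iff)
  then have "(\<Sum>j\<in>J. 1 / (1 + (real_of_int j)\<^sup>2)) \<le> (\<Sum>j\<in>{- int n..int n}. 1 / (1 + (real_of_int j)\<^sup>2))"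
    by (intro sum_mono2) (auto simp: add_nonneg_nonneg)
  also note le[of n]
  also have "5 - 2 / (real n + 1/2) \<le> 5" by simp
  finally show ?thesis .
qed

text \<open>
  The exponent \<open>m\<close> lets the weight be bounded by the product of the one-dimensional weights
  \<open>1 / (1 + k_i\<^sup>2)\<close>, and the sum of a product over a lattice box factorises.
\<close>

lemma sum_lattice_weight_le:
  fixes F :: "(int^'m) set"
  assumes "finite F"
  shows "(\<Sum>k\<in>F. inverse ((1 + (norm (real_vec k))\<^sup>2) ^ CARD('m))) \<le> 5 ^ CARD('m)"
proof -
  define J where "J = (\<Union>k\<in>F. range (($) k))"
  have J: "finite J" using assms by (simp add: J_def)
  define P where "P = PiE (UNIV :: 'm set) (\<lambda>_. J)"
  define T :: "('m \<Rightarrow> int) \<Rightarrow> int^'m" where "T g = (\<chi> i. g i)" for g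
  have P: "finite P" unfolding P_def using J by (intro finite_PiE) auto
  have T: "inj_on T P" by (auto simp: inj_on_def T_def vec_eq_iff)
  have "F \<subseteq> T ` P"
  proof
    fix k assume "k \<in> F"
    then have "T (($) k) \<in> T ` P" unfolding P_def J_def by (intro imageI) auto
    then show "k \<in> T ` P" by (simp add: T_def)
  qed
  let ?w = "\<lambda>k::int^'m. \<Prod>i\<in>UNIV. 1 / (1 + (real_of_int (k $ i))\<^sup>2)"
  have "inverse ((1 + (norm (real_vec k))\<^sup>2) ^ CARD('m)) \<le> ?w k" for k :: "int^'m"
  proof -
    have "inverse ((1 + (norm (real_vec k))\<^sup>2) ^ CARD('m)) = (\<Prod>i\<in>(UNIV::'m set). 1 / (1 + (norm (real_vec k))\<^sup>2))"
      by (simp add: power_one_over inverse_eq_divide)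
    also have "\<dots> \<le> ?w k"
      using square_component_le[of "real_vec k"]
      by (intro prod_mono conjI divide_left_mono mult_pos_pos) (auto simp: add_pos_nonneg)
    finally show ?thesis .
  qed
  then have "(\<Sum>k\<in>F. inverse ((1 + (norm (real_vec k))\<^sup>2) ^ CARD('m))) \<le> (\<Sum>k\<in>F. ?w k)"
    by (rule sum_mono)
  also have "\<dots> \<le> (\<Sum>k\<in>T ` P. ?w k)"
    using P \<open>F \<subseteq> T ` P\<close> by (intro sum_mono2) (auto intro!: prod_nonneg add_nonneg_nonneg)
  also have "\<dots> = (\<Sum>g\<in>P. \<Prod>i\<in>UNIV. 1 / (1 + (real_of_int (g i))\<^sup>2))"
    by (subst sum.reindex[OF T]) (simp add: T_def)
  also have "\<dots> = (\<Prod>i\<in>(UNIV::'m set). \<Sum>j\<in>J. 1 / (1 + (real_of_int j)\<^sup>2))"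
    unfolding P_def using J by (intro prod_sum_PiE[symmetric]) auto
  also have "\<dots> \<le> 5 ^ CARD('m)"
    using sum_inverse_square_int_le[OF J] by (simp add: power_mono sum_nonneg add_nonneg_nonneg)
  finally show ?thesis .
qed

lemma abs_monomial_le: "\<bar>monomial \<alpha> y\<bar> \<le> (1 + (norm y)\<^sup>2) ^ (\<Sum>i\<in>UNIV. \<alpha> $ i)"
proof -
  have "\<bar>y $ i\<bar> \<le> 1 + (norm y)\<^sup>2" for i
  proof -
    have "0 \<le> (\<bar>y $ i\<bar> - 1)\<^sup>2" by simp
    then have "\<bar>y $ i\<bar> \<le> 1 + (y $ i)\<^sup>2"
      by (simp add: power2_diff)
    then show ?thesis using square_component_le[of y i] by simp
  qed
  then have "\<bar>monomial \<alpha> y\<bar> \<le> (\<Prod>i\<in>UNIV. (1 + (norm y)\<^sup>2) ^ (\<alpha> $ i))"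
    unfolding monomial_def abs_prod power_abs by (intro prod_mono) (auto intro: power_mono)
  then show ?thesis by (simp add: power_sum)
qed

text \<open>
  Finitely many monomials control the weight: if \<open>z\<close> is the largest of \<open>1\<close> and the squares
  \<open>y_j\<^sup>2\<close>, then \<open>1 + \<bar>y\<bar>\<^sup>2 \<le> (n + 1) z\<close>, and \<open>z ^ M\<close> is itself the absolute value of a monomial,
  namely \<open>1\<close> or \<open>y_j ^ (2 M)\<close>.
\<close>

lemma weight_le_sum_monomials:
  obtains A :: "(nat^'n) set" and c :: real where "finite A" "c > 0"
    "\<And>y. (1 + (norm y)\<^sup>2) ^ M \<le> c * (\<Sum>\<alpha>\<in>A. \<bar>monomial \<alpha> y\<bar>)"
proof
  define A :: "(nat^'n) set" where "A = insert 0 (range (\<lambda>j. axis j (2 * M)))"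
  show A: "finite A" by (simp add: A_def)
  show "(real CARD('n) + 1) ^ M > 0" by simp
  fix y :: "real^'n"
  define z where "z = Max (insert 1 (range (\<lambda>j. (y $ j)\<^sup>2)))"
  have z: "1 \<le> z" "\<And>j. (y $ j)\<^sup>2 \<le> z" unfolding z_def by (intro Max_ge; simp)+
  have "1 + (norm y)\<^sup>2 \<le> 1 * z + (\<Sum>j\<in>(UNIV::'n set). z)"
    unfolding norm_square_vec using z by (intro add_mono sum_mono) auto
  then have "1 + (norm y)\<^sup>2 \<le> (real CARD('n) + 1) * z" by (simp add: algebra_simps)
  then have "(1 + (norm y)\<^sup>2) ^ M \<le> ((real CARD('n) + 1) * z) ^ M"
    by (intro power_mono) auto
  also have "\<dots> = (real CARD('n) + 1) ^ M * z ^ M" by (rule power_mult_distrib)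
  also have "z ^ M \<le> (\<Sum>\<alpha>\<in>A. \<bar>monomial \<alpha> y\<bar>)"
  proof -
    have "z \<in> insert 1 (range (\<lambda>j. (y $ j)\<^sup>2))" unfolding z_def by (intro Max_in) auto
    then have "\<exists>\<alpha>\<in>A. z ^ M = \<bar>monomial \<alpha> y\<bar>"
    proof
      assume "z = 1"
      then show ?thesis by (intro bexI[of _ 0]) (auto simp: A_def monomial_def)
    next
      assume "z \<in> range (\<lambda>j. (y $ j)\<^sup>2)"
      then obtain j where j: "z = (y $ j)\<^sup>2" by auto
      have "monomial (axis j (2 * M)) y = (\<Prod>i\<in>UNIV. if i = j then (y $ j) ^ (2 * M) else 1)"
        unfolding monomial_def by (intro prod.cong) (auto simp: axis_def)
      then have "monomial (axis j (2 * M)) y = z ^ M"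
        by (simp add: j power_mult)
      then show ?thesis using z by (intro bexI[of _ "axis j (2 * M)"]) (auto simp: A_def)
    qed
    then obtain \<alpha> where "\<alpha> \<in> A" "z ^ M = \<bar>monomial \<alpha> y\<bar>" by blast
    then show ?thesis using A member_le_sum[of \<alpha> A "\<lambda>\<alpha>. \<bar>monomial \<alpha> y\<bar>"] by auto
  qed
  finally show "(1 + (norm y)\<^sup>2) ^ M \<le> (real CARD('n) + 1) ^ M * (\<Sum>\<alpha>\<in>A. \<bar>monomial \<alpha> y\<bar>)"
    by (simp add: mult_left_mono)
qed

section \<open>Decay of the coefficients and the Schwartz seminorms\<close>

text \<open>
  The supremum runs over a nonempty set of nonnegative numbers, so its only possible infinite
  value is \<open>\<infinity>\<close>.
\<close>

lemma schwartz_seminorm_finite_iff: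
  "schwartz_seminorm \<alpha> \<beta> \<gamma> f < \<infinity> \<longleftrightarrow>
    (\<exists>B. \<forall>t x. \<bar>monomial \<gamma> x\<bar> * cmod (deriv_t \<alpha> (deriv_x \<beta> f) (t, x)) \<le> B)"
proof
  assume "schwartz_seminorm \<alpha> \<beta> \<gamma> f < \<infinity>"
  moreover have le: "ereal (\<bar>monomial \<gamma> x\<bar> * cmod (deriv_t \<alpha> (deriv_x \<beta> f) (t, x))) \<le> schwartz_seminorm \<alpha> \<beta> \<gamma> f" for t x
    unfolding schwartz_seminorm_def by (rule SUP_upper2[of "(t, x)"]) (auto simp: norm_mult)
  moreover have "schwartz_seminorm \<alpha> \<beta> \<gamma> f \<noteq> - \<infinity>" using le[of 0 0] by auto
  ultimately obtain B where "schwartz_seminorm \<alpha> \<beta> \<gamma> f = ereal B"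
    by (cases "schwartz_seminorm \<alpha> \<beta> \<gamma> f") auto
  then show "\<exists>B. \<forall>t x. \<bar>monomial \<gamma> x\<bar> * cmod (deriv_t \<alpha> (deriv_x \<beta> f) (t, x)) \<le> B"
    using le by (auto intro!: exI[of _ B])
next
  assume "\<exists>B. \<forall>t x. \<bar>monomial \<gamma> x\<bar> * cmod (deriv_t \<alpha> (deriv_x \<beta> f) (t, x)) \<le> B"
  then obtain B where "\<And>t x. \<bar>monomial \<gamma> x\<bar> * cmod (deriv_t \<alpha> (deriv_x \<beta> f) (t, x)) \<le> B" by blast
  then have "schwartz_seminorm \<alpha> \<beta> \<gamma> f \<le> ereal B"
    unfolding schwartz_seminorm_def by (intro SUP_least) (auto simp: norm_mult)
  then show "schwartz_seminorm \<alpha> \<beta> \<gamma> f < \<infinity>" by (rule order_le_less_trans) simp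
qed

lemma norm_torus_fourier_deriv_t:
  assumes "f \<in> smooth_torus"
  shows "cmod (torus_fourier (deriv_t \<alpha> f) k x) = \<bar>monomial \<alpha> (real_vec k)\<bar> * cmod (torus_fourier f k x)"
  by (simp add: torus_fourier_deriv_t[OF assms] norm_mult norm_power monomial_def abs_prod power_abs flip: prod_norm)

lemma smooth_torus_derivs:
  "f \<in> smooth_torus \<Longrightarrow> deriv_t \<alpha> f \<in> smooth_torus"
  "f \<in> smooth_torus \<Longrightarrow> deriv_x \<beta> f \<in> smooth_torus"
  by (rule smooth_torus_multi_deriv; simp add: Basis_prod_def)+

lemma torus_fourier_smooth:
  assumes "f \<in> smooth_torus"
  shows "torus_fourier f k x = torus_mean (\<lambda>t. f (t, x) * torus_char (- k) t)"
  by (rule torus_fourier_eq_torus_mean) (intro C_infinity_continuous smooth_torus_C_infinity assms)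

text \<open>
  A monomial in \<open>k\<close> times the coefficient of \<open>g\<close> is, up to a unimodular factor, a coefficient of
  a torus derivative of \<open>g\<close>, and a coefficient is at most the supremum norm. The weights are
  reduced to monomials by \<open>weight_le_sum_monomials\<close>.
\<close>

lemma fourier_decay_of_seminorms:
  fixes g :: "(real^'m) \<times> (real^'n) \<Rightarrow> complex"
  assumes g: "g \<in> smooth_torus"
    and B: "\<And>\<alpha> \<gamma> t x. \<bar>monomial \<gamma> x\<bar> * cmod (deriv_t \<alpha> g (t, x)) \<le> B \<alpha> \<gamma>"
  shows "\<exists>C>0. \<forall>k x. (1 + (norm (real_vec k))\<^sup>2) ^ M * (1 + (norm x)\<^sup>2) ^ M * cmod (torus_fourier g k x) \<le> C"
proof -
  obtain A :: "(nat^'m) set" and a where A: "finite A" "a > 0"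
    "\<And>y. (1 + (norm y)\<^sup>2) ^ M \<le> a * (\<Sum>\<alpha>\<in>A. \<bar>monomial \<alpha> y\<bar>)"
    by (rule weight_le_sum_monomials[where M = M and ?'n = 'm]) blast
  obtain A' :: "(nat^'n) set" and a' where A': "finite A'" "a' > 0"
    "\<And>y. (1 + (norm y)\<^sup>2) ^ M \<le> a' * (\<Sum>\<gamma>\<in>A'. \<bar>monomial \<gamma> y\<bar>)"
    by (rule weight_le_sum_monomials[where M = M and ?'n = 'n]) blast
  have coeff: "\<bar>monomial \<alpha> (real_vec k)\<bar> * \<bar>monomial \<gamma> x\<bar> * cmod (torus_fourier g k x) \<le> B \<alpha> \<gamma>" for \<alpha> \<gamma> k x
  proof -
    let ?h = "\<lambda>t. monomial \<gamma> x * (deriv_t \<alpha> g (t, x) * torus_char (- k) t)"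
    note g' = smooth_torus_derivs(1)[OF g, of \<alpha>]
    have "\<bar>monomial \<alpha> (real_vec k)\<bar> * \<bar>monomial \<gamma> x\<bar> * cmod (torus_fourier g k x) =
        cmod (monomial \<gamma> x * torus_fourier (deriv_t \<alpha> g) k x)"
      by (simp add: norm_mult norm_torus_fourier_deriv_t[OF g] mult_ac)
    also have "\<dots> = cmod (torus_mean ?h)"
      by (simp add: torus_fourier_smooth[OF g'] torus_mean_mult_left)
    also have "\<dots> \<le> torus_mean (\<lambda>t::real^'m. B \<alpha> \<gamma>)"
      by (rule norm_torus_mean_le)
        (auto intro!: continuous_intros continuous_torus_char continuous_on_smooth_slice g' simp: norm_mult B)
    finally show ?thesis by (simp add: torus_mean_const)
  qed
  have bound: "(1 + (norm (real_vec k))\<^sup>2) ^ M * (1 + (norm x)\<^sup>2) ^ M * cmod (torus_fourier g k x)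
      \<le> a * a' * (\<Sum>\<alpha>\<in>A. \<Sum>\<gamma>\<in>A'. B \<alpha> \<gamma>)" for k x
  proof -
    have "(1 + (norm (real_vec k))\<^sup>2) ^ M * (1 + (norm x)\<^sup>2) ^ M * cmod (torus_fourier g k x)
        \<le> (a * (\<Sum>\<alpha>\<in>A. \<bar>monomial \<alpha> (real_vec k)\<bar>)) * (a' * (\<Sum>\<gamma>\<in>A'. \<bar>monomial \<gamma> x\<bar>)) * cmod (torus_fourier g k x)"
      using A A' by (intro mult_right_mono mult_mono mult_nonneg_nonneg sum_nonneg) auto
    also have "\<dots> = a * a' * (\<Sum>\<alpha>\<in>A. \<Sum>\<gamma>\<in>A'. \<bar>monomial \<alpha> (real_vec k)\<bar> * \<bar>monomial \<gamma> x\<bar> * cmod (torus_fourier g k x))"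
      by (simp add: sum_product sum_distrib_right sum_distrib_left mult_ac)
    also have "\<dots> \<le> a * a' * (\<Sum>\<alpha>\<in>A. \<Sum>\<gamma>\<in>A'. B \<alpha> \<gamma>)"
      using A A' by (intro mult_left_mono sum_mono coeff) auto
    finally show ?thesis .
  qed
  show ?thesis
    \<comment> \<open>The maximum with \<open>1\<close> only makes the constant positive.\<close>
    by (rule exI[of _ "max 1 (a * a' * (\<Sum>\<alpha>\<in>A. \<Sum>\<gamma>\<in>A'. B \<alpha> \<gamma>))"])
      (use bound in \<open>auto simp: le_max_iff_disj\<close>)
qed

text \<open>
  The exponent \<open>M\<close> pays for three things: the monomial \<open>k ^ \<alpha>\<close> produced by the torus
  derivatives, the monomial \<open>x ^ \<gamma>\<close>, and a remaining weight \<open>(1 + \<bar>k\<bar>\<^sup>2) ^ (-m)\<close> that makes the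
  coefficients summable over the lattice, with sum at most \<open>C * 5 ^ m\<close>, uniformly in \<open>x\<close>.
\<close>

lemma seminorm_bound_of_fourier_decay:
  fixes g :: "(real^'m) \<times> (real^'n) \<Rightarrow> complex"
  assumes g: "g \<in> smooth_torus"
    and M: "M = (\<Sum>i\<in>UNIV. \<alpha> $ i) + (\<Sum>j\<in>UNIV. \<gamma> $ j) + CARD('m)"
    and C: "\<And>k x. (1 + (norm (real_vec k))\<^sup>2) ^ M * (1 + (norm x)\<^sup>2) ^ M * cmod (torus_fourier g k x) \<le> C"
  shows "\<bar>monomial \<gamma> x\<bar> * cmod (deriv_t \<alpha> g (t, x)) \<le> C * 5 ^ CARD('m)"
proof -
  note g' = smooth_torus_derivs(1)[OF g, of \<alpha>]
  let ?h = "\<lambda>t. monomial \<gamma> x * deriv_t \<alpha> g (t, x)"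
  let ?c = "\<lambda>k. torus_mean (\<lambda>t. ?h t * torus_char (- k) t)"
  have "0 \<le> (1 + (norm (real_vec (0::int^'m)))\<^sup>2) ^ M * (1 + (norm (0::real^'n))\<^sup>2) ^ M * cmod (torus_fourier g 0 0)"
    by simp
  also have "\<dots> \<le> C" by (rule C)
  finally have "0 \<le> C" .
  have coeff: "cmod (?c k) \<le> C * inverse ((1 + (norm (real_vec k))\<^sup>2) ^ CARD('m))" for k
  proof -
    define K where "K = 1 + (norm (real_vec k))\<^sup>2"
    define X where "X = 1 + (norm x)\<^sup>2"
    have K: "K \<ge> 1" and X: "X \<ge> 1" by (auto simp: K_def X_def)
    have "?c k = monomial \<gamma> x * torus_fourier (deriv_t \<alpha> g) k x"
      by (simp add: torus_fourier_smooth[OF g'] mult.assoc torus_mean_mult_left)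
    then have "cmod (?c k) * K ^ CARD('m) =
        \<bar>monomial \<alpha> (real_vec k)\<bar> * K ^ CARD('m) * \<bar>monomial \<gamma> x\<bar> * cmod (torus_fourier g k x)"
      by (simp add: norm_mult norm_torus_fourier_deriv_t[OF g] mult_ac)
    also have "\<dots> \<le> K ^ (\<Sum>i\<in>UNIV. \<alpha> $ i) * K ^ CARD('m) * X ^ (\<Sum>j\<in>UNIV. \<gamma> $ j) * cmod (torus_fourier g k x)"
      unfolding K_def X_def by (intro mult_right_mono mult_mono abs_monomial_le) auto
    also have "\<dots> \<le> K ^ M * X ^ M * cmod (torus_fourier g k x)"
      unfolding power_add[symmetric] using K X
      by (intro mult_right_mono mult_mono power_increasing) (auto simp: M)
    also have "\<dots> \<le> C" using C by (simp add: K_def X_def)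
    finally have "cmod (?c k) \<le> C / K ^ CARD('m)" using K by (simp add: field_simps)
    then show ?thesis by (simp add: K_def divide_inverse)
  qed
  have "cmod (?h t) \<le> C * 5 ^ CARD('m)"
  proof (rule norm_le_sum_fourier_coeffs[where h = ?h])
    show "continuous_on UNIV ?h"
      by (intro continuous_intros continuous_on_smooth_slice g')
    show "periodic ?h" using periodic_smooth_slice[OF g'] by (simp add: periodic_def)
    fix F :: "(int^'m) set" assume F: "finite F"
    have "(\<Sum>k\<in>F. cmod (?c k)) \<le> (\<Sum>k\<in>F. C * inverse ((1 + (norm (real_vec k))\<^sup>2) ^ CARD('m)))"
      by (intro sum_mono coeff)
    also have "\<dots> \<le> C * 5 ^ CARD('m)"
      unfolding sum_distrib_left[symmetric]
      by (intro mult_left_mono sum_lattice_weight_le F \<open>0 \<le> C\<close>)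
    finally show "(\<Sum>k\<in>F. cmod (?c k)) \<le> C * 5 ^ CARD('m)" .
  qed
  then show ?thesis by (simp add: norm_mult)
qed

lemma powr_weight: "(1 + (norm x)\<^sup>2) powr (- real M) = inverse ((1 + (norm x)\<^sup>2) ^ M)"
  by (simp add: powr_minus powr_realpow add_pos_nonneg)

theorem proposition2p1:
  fixes f :: "(real^'m) \<times> (real^'n) \<Rightarrow> complex"
  assumes "f \<in> smooth_torus \<inter> L1_torus"
  shows "f \<in> schwartz_torus \<longleftrightarrow>
    (\<forall>(\<beta> :: nat^'n) (N :: real). N > 0 \<longrightarrow>
      (\<exists>C > 0. \<forall>(k :: int^'m) (x :: real^'n).
        cmod (deriv_vec \<beta> (torus_fourier f k) x)
          \<le> C * (1 + (norm (real_vec k))\<^sup>2) powr (- N / 2) * (1 + (norm x)\<^sup>2) powr (- N / 2)))"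
proof -
  from assms have f: "f \<in> smooth_torus" by simp
  note g = smooth_torus_derivs(2)[OF f]
  have schwartz: "f \<in> schwartz_torus \<longleftrightarrow> (\<forall>\<alpha> \<beta> \<gamma>. \<exists>B. \<forall>t x. \<bar>monomial \<gamma> x\<bar> * cmod (deriv_t \<alpha> (deriv_x \<beta> f) (t, x)) \<le> B)"
    using f unfolding schwartz_torus_def schwartz_seminorm_finite_iff by simp
  show ?thesis
    unfolding deriv_vec_torus_fourier[OF f]
  proof (intro iffI allI impI)
    fix \<beta> :: "nat^'n" and N :: real
    assume "f \<in> schwartz_torus" "N > 0"
    then have "\<forall>\<alpha> \<gamma>. \<exists>B. \<forall>t x. \<bar>monomial \<gamma> x\<bar> * cmod (deriv_t \<alpha> (deriv_x \<beta> f) (t, x)) \<le> B"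
      by (simp add: schwartz)
    then obtain B where B: "\<And>\<alpha> \<gamma> t x. \<bar>monomial \<gamma> x\<bar> * cmod (deriv_t \<alpha> (deriv_x \<beta> f) (t, x)) \<le> B \<alpha> \<gamma>"
      unfolding choice_iff by blast
    \<comment> \<open>Natural exponents suffice, since the weights are at least \<open>1\<close> and a larger exponent gives a stronger bound.\<close>
    define M where "M = nat \<lceil>N / 2\<rceil>"
    have M: "- real M \<le> - N / 2" by (simp add: M_def) linarith
    obtain C where C: "C > 0" "\<And>k x. (1 + (norm (real_vec k))\<^sup>2) ^ M * (1 + (norm x)\<^sup>2) ^ M *
        cmod (torus_fourier (deriv_x \<beta> f) k x) \<le> C"
      using fourier_decay_of_seminorms[OF g B, of M] by blast
    show "\<exists>C>0. \<forall>k x. cmod (torus_fourier (deriv_x \<beta> f) k x)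
        \<le> C * (1 + (norm (real_vec k))\<^sup>2) powr (- N / 2) * (1 + (norm x)\<^sup>2) powr (- N / 2)"
    proof (intro exI[of _ C] conjI allI C(1))
      fix k :: "int^'m" and x :: "real^'n"
      let ?K = "1 + (norm (real_vec k))\<^sup>2" and ?X = "1 + (norm x)\<^sup>2"
      have "?K ^ M * ?X ^ M > 0" by (intro mult_pos_pos zero_less_power) (auto simp: add_pos_nonneg)
      then have "cmod (torus_fourier (deriv_x \<beta> f) k x) \<le> C / (?K ^ M * ?X ^ M)"
        using C(2)[of k x] by (simp add: pos_le_divide_eq mult.commute)
      also have "\<dots> = C * ?K powr (- real M) * ?X powr (- real M)"
        unfolding powr_weight by (simp add: field_simps)
      also have "\<dots> \<le> C * ?K powr (- N / 2) * ?X powr (- N / 2)"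
        using M C(1) by (intro mult_mono mult_left_mono powr_mono) auto
      finally show "cmod (torus_fourier (deriv_x \<beta> f) k x) \<le> C * ?K powr (- N / 2) * ?X powr (- N / 2)" .
    qed
  next
    assume decay: "\<forall>\<beta> N. N > 0 \<longrightarrow> (\<exists>C>0. \<forall>k x. cmod (torus_fourier (deriv_x \<beta> f) k x)
        \<le> C * (1 + (norm (real_vec k))\<^sup>2) powr (- N / 2) * (1 + (norm x)\<^sup>2) powr (- N / 2))"
    show "f \<in> schwartz_torus"
      unfolding schwartz
    proof (intro allI)
      fix \<alpha> :: "nat^'m" and \<beta> \<gamma> :: "nat^'n"
      define M where "M = (\<Sum>i\<in>UNIV. \<alpha> $ i) + (\<Sum>j\<in>UNIV. \<gamma> $ j) + CARD('m)"
      have "M > 0" by (simp add: M_def)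
      then have "2 * real M > 0" by simp
      with decay obtain C where "\<And>k x. cmod (torus_fourier (deriv_x \<beta> f) k x)
          \<le> C * (1 + (norm (real_vec k))\<^sup>2) powr (- (2 * real M) / 2) * (1 + (norm x)\<^sup>2) powr (- (2 * real M) / 2)"
        by blast
      then have C: "cmod (torus_fourier (deriv_x \<beta> f) k x) \<le>
          C * inverse ((1 + (norm (real_vec k))\<^sup>2) ^ M) * inverse ((1 + (norm x)\<^sup>2) ^ M)" for k x
        by (simp add: powr_weight)
      have "(1 + (norm (real_vec k))\<^sup>2) ^ M * (1 + (norm x)\<^sup>2) ^ M * cmod (torus_fourier (deriv_x \<beta> f) k x) \<le> C" for k x
      proof -
        have pos: "(1 + (norm (real_vec k))\<^sup>2) ^ M > 0" "(1 + (norm x)\<^sup>2) ^ M > 0"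
          by (auto simp: add_pos_nonneg)
        then show ?thesis using C[of k x] by (simp add: field_simps)
      qed
      from seminorm_bound_of_fourier_decay[OF g M_def this]
      show "\<exists>B. \<forall>t x. \<bar>monomial \<gamma> x\<bar> * cmod (deriv_t \<alpha> (deriv_x \<beta> f) (t, x)) \<le> B" by blast
    qed
  qed
qed

end
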